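(* Let $p$ be a prime and let $n=p^e$ with $e\ge 1$ be a power of $p$. Let $S$ be a sequence of $2n-2$ integers coprime to $n$. Then $S$ has no subsequence of length at most $n$ whose sum $\sigma$ satisfies $\gcd(\sigma,n^2)=n$ if and only if there exists an integer $c$ coprime to $n$ such that $n-1$ terms of $S$ are congruent to $c$ modulo $np$ and the other $n-1$ terms of $S$ are congruent to $-c$ modulo $np$. In fact, such a sequence $S$ (i.e. one satisfying these equivalent conditions) has no subsequence (of any length) whose sum $\sigma$ satisfies $\gcd(\sigma,n^2)=n$.
   Context: Sequences are finite and unordered with repetition allowed (multisets); a subsequence is a sub-multiset, and its length is the number of its terms counted with multiplicity. *)

theory Defs
  imports "HOL-Library.Multiset" "HOL-Number_Theory.Number_Theory"
begin

end

theory Submission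
  imports Defs "HOL-Computational_Algebra.Polynomial"
begin

text \<open>
  The gcd condition says that \<open>p\<close> divides the sum exactly \<open>e\<close> times. Since \<open>n\<close> integers always
  contain a nonempty zero-sum subsequence modulo \<open>n\<close>, the bound on the length may be dropped.
  The integer-valued polynomial \<open>F(z) = (z choose n) (z - 1 choose n - 1)\<close> of degree \<open>2n - 1\<close> is
  divisible by \<open>p\<close> unless \<open>p\<close> divides \<open>z\<close> exactly \<open>e\<close> times, and its leading coefficient times
  \<open>(2n - 1)!\<close> is prime to \<open>p\<close>. Differencing \<open>F\<close> along \<open>2n - 1\<close> units yields a nonzero constant
  modulo \<open>p\<close>, so \<open>2n - 1\<close> units always have a subsequence of the required kind. If \<open>2n - 2\<close> units
  have none, differencing along all but two terms \<open>a, b\<close> yields a cubic which vanishes modulo \<open>p\<close> at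
  \<open>0, a, b, a + b\<close>; hence \<open>a\<close> and \<open>b\<close> agree up to sign modulo \<open>p\<close>.

  For the passage to modulus \<open>np\<close>, suppose a pair \<open>x, y\<close> has \<open>p\<close>-adic valuation \<open>k\<close> of its sum, where
  \<open>1 \<le> k \<le> e\<close> and \<open>p\<^sup>k > 2\<close>. Blocks of at most \<open>p\<^sup>k\<close> terms with sum of valuation \<open>k\<close> can be extracted
  greedily from the rest; together with the pair, which is shorter than \<open>p\<^sup>k\<close>, they number
  \<open>2p\<^sup>e\<^sup>-\<^sup>k - 1\<close>, and the first result applied to the block sums divided by \<open>p\<^sup>k\<close> is contradictory.
\<close>

subsection \<open>Iterated differences of polynomials\<close>

definition poly_diff :: "'a \<Rightarrow> 'a poly \<Rightarrow> 'a::comm_ring_1 poly"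
  where "poly_diff x f = pcompose f [:x, 1:] - f"

lemma poly_poly_diff: "poly (poly_diff x f) y = poly f (y + x) - poly f y"
  by (simp add: poly_diff_def poly_pcompose add.commute)

text \<open>Induction on the Horner form: f = a + X g gives f(X + x) = a + (X + x) g(X + x). The two
  top coefficients are carried together, since the second one of this product involves both of those
  of g(X + x).\<close>

lemma pcompose_shift_top_coeffs:
  fixes f :: "'a::idom poly"
  assumes "degree f \<le> Suc n"
  shows "degree (pcompose f [:x, 1:]) \<le> Suc n \<and>
    coeff (pcompose f [:x, 1:]) (Suc n) = coeff f (Suc n) \<and>
    coeff (pcompose f [:x, 1:]) n = coeff f n + of_nat (Suc n) * x * coeff f (Suc n)"
  using assms
proof (induction n arbitrary: f)
  case 0
  obtain a g where f: "f = pCons a g" by (cases f)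
  have "degree g = 0" using 0 f by (cases "g = 0") auto
  then obtain b where "g = [:b:]" by (metis degree_eq_zeroE)
  with f show ?case by (simp add: pcompose_pCons algebra_simps)
next
  case (Suc n)
  obtain a g where f: "f = pCons a g" by (cases f)
  have "degree g \<le> Suc n" using Suc.prems f by (cases "g = 0") auto
  note IH = Suc.IH[OF this]
  have eq: "pcompose f [:x, 1:] = [:a:] + [:x, 1:] * pcompose g [:x, 1:]"
    by (simp add: f pcompose_pCons)
  have "degree ([:x, 1:] * pcompose g [:x, 1:]) \<le> 1 + Suc n"
    using degree_mult_le[of "[:x, 1:]" "pcompose g [:x, 1:]"] IH by simp
  then have deg: "degree (pcompose f [:x, 1:]) \<le> Suc (Suc n)"
    unfolding eq by (intro degree_add_le) auto
  have top: "coeff (pcompose g [:x, 1:]) (Suc (Suc n)) = 0"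
    "coeff g (Suc (Suc n)) = 0"
    using IH \<open>degree g \<le> Suc n\<close> by (auto intro!: coeff_eq_0)
  show ?case
    using deg IH top by (simp add: eq) (simp add: f algebra_simps)
qed

lemma poly_diff_top_coeff:
  fixes f :: "'a::idom poly"
  assumes "degree f \<le> Suc n"
  shows "degree (poly_diff x f) \<le> n"
    and "coeff (poly_diff x f) n = of_nat (Suc n) * x * coeff f (Suc n)"
proof -
  note top = pcompose_shift_top_coeffs[OF assms, of x]
  have "degree (poly_diff x f) \<le> Suc n"
    unfolding poly_diff_def using top assms by (intro degree_diff_le) auto
  moreover have "coeff (poly_diff x f) (Suc n) = 0"
    using top by (simp add: poly_diff_def)
  ultimately show "degree (poly_diff x f) \<le> n"
    by (metis coeff_0 degree_0 le_Suc_eq le_degree leading_coeff_0_iff zero_le)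
  show "coeff (poly_diff x f) n = of_nat (Suc n) * x * coeff f (Suc n)"
    using top by (simp add: poly_diff_def)
qed

fun iter_poly_diff :: "'a list \<Rightarrow> 'a poly \<Rightarrow> 'a::comm_ring_1 poly" where
  "iter_poly_diff [] f = f"
| "iter_poly_diff (x # xs) f = iter_poly_diff xs (poly_diff x f)"

text \<open>Integer counterpart of \<open>iter_poly_diff\<close>: divisibility by \<open>p\<close>
  is read off here, top coefficients over a field there.\<close>

fun iter_diff :: "int list \<Rightarrow> (int \<Rightarrow> int) \<Rightarrow> int \<Rightarrow> int" where
  "iter_diff [] F = F"
| "iter_diff (x # xs) F = iter_diff xs (\<lambda>y. F (y + x) - F y)"

text \<open>Each difference lowers the degree bound by one and multiplies the top coefficient by the
  old bound times the step; the bounds multiply up to a quotient of factorials. The free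
  \<open>d\<close> serves both the constant (\<open>d = 0\<close>) and the cubic
  (\<open>d = 3\<close>) below.\<close>

lemma iter_poly_diff_top_coeff:
  fixes f :: "'a::field_char_0 poly"
  assumes "degree f \<le> d + length xs"
  shows "degree (iter_poly_diff xs f) \<le> d \<and>
    coeff (iter_poly_diff xs f) d = fact (d + length xs) / fact d * prod_list xs * coeff f (d + length xs)"
  using assms
proof (induction xs arbitrary: f)
  case (Cons x xs)
  have deg: "degree f \<le> Suc (d + length xs)" using Cons.prems by simp
  show ?case
    using Cons.IH[OF poly_diff_top_coeff(1)[OF deg]] poly_diff_top_coeff(2)[OF deg, of x]
    by (simp add: algebra_simps)
qed simp

lemma poly_iter_poly_diff:
  fixes f :: "'a::{idom, ring_char_0} poly"
  assumes "\<And>z. poly f (of_int z) = of_int (F z)"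
  shows "poly (iter_poly_diff (map of_int xs) f) (of_int y) = of_int (iter_diff xs F y)"
  using assms
proof (induction xs arbitrary: f F)
  case (Cons x xs)
  have "poly (poly_diff (of_int x) f) (of_int z) = of_int (F (z + x) - F z)" for z
    using Cons.prems[of "z + x"] Cons.prems[of z] by (simp add: poly_poly_diff)
  then show ?case using Cons.IH[of "poly_diff (of_int x) f" "\<lambda>y. F (y + x) - F y"] by simp
qed simp

text \<open>Unfolded, the iterated difference is a signed sum of values of \<open>F\<close> at
  \<open>y\<close> plus the sums of sub-multisets of \<open>xs\<close>.\<close>

lemma dvd_iter_diff:
  assumes "\<And>T. T \<subseteq># mset xs \<Longrightarrow> p dvd F (y + \<Sum>\<^sub># T)"
  shows "p dvd iter_diff xs F y"
  using assms
proof (induction xs arbitrary: F)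
  case Nil
  then show ?case using Nil[of "{#}"] by simp
next
  case (Cons x xs)
  have "p dvd F (y + \<Sum>\<^sub># T + x) - F (y + \<Sum>\<^sub># T)" if "T \<subseteq># mset xs" for T
  proof (rule dvd_diff)
    show "p dvd F (y + \<Sum>\<^sub># T + x)"
      using Cons.prems[of "add_mset x T"] that by (simp add: add_ac)
    have "T \<subseteq># mset (x # xs)" by (rule subset_mset.trans[OF that]) simp
    then show "p dvd F (y + \<Sum>\<^sub># T)" by (rule Cons.prems)
  qed
  then show ?case using Cons.IH[of "\<lambda>y. F (y + x) - F y"] by simp
qed

subsection \<open>A product of binomial coefficients\<close>

definition exact_power :: "nat \<Rightarrow> nat \<Rightarrow> int \<Rightarrow> bool"
  where "exact_power p k z \<longleftrightarrow> int p ^ k dvd z \<and> \<not> int p ^ Suc k dvd z"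

text \<open>The division is exact: this is the generalized binomial coefficient, for negative
  \<open>z\<close> as well.\<close>

definition int_binomial :: "int \<Rightarrow> nat \<Rightarrow> int"
  where "int_binomial z k = (\<Prod>i=0..<k. z - int i) div fact k"

lemma of_int_int_binomial:
  "(of_int (int_binomial z k) :: 'a::field_char_0) = (\<Prod>i=0..<k. of_int z - of_nat i) / fact k"
  unfolding int_binomial_def using of_int_gbinomial[of z k, where 'a='a]
  unfolding gbinomial_prod_rev by simp

definition binom_prod :: "nat \<Rightarrow> int \<Rightarrow> int"
  where "binom_prod n z = int_binomial z n * int_binomial (z - 1) (n - 1)"

definition binom_prod_poly :: "nat \<Rightarrow> rat poly"
  where "binom_prod_poly n = smult (1 / (fact n * fact (n - 1)))
    ((\<Prod>i<n. [:- of_nat i, 1:]) * (\<Prod>i<n-1. [:- of_nat (Suc i), 1:]))"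

lemma poly_binom_prod_poly:
  "poly (binom_prod_poly n) (of_int z) = of_int (binom_prod n z)"
  by (simp add: binom_prod_poly_def binom_prod_def of_int_int_binomial poly_prod
      atLeast0LessThan algebra_simps)

lemma binom_prod_poly_top_coeff:
  assumes "n > 0"
  shows "degree (binom_prod_poly n) = 2 * n - 1"
    and "coeff (binom_prod_poly n) (2 * n - 1) = 1 / (fact n * fact (n - 1))"
proof -
  let ?A = "(\<Prod>i<n. [:- of_nat i, 1:]) :: rat poly" and ?B = "(\<Prod>i<n-1. [:- of_nat (Suc i), 1:]) :: rat poly"
  have deg: "degree ?A = n" "degree ?B = n - 1"
    by (subst degree_prod_eq_sum_degree; simp)+
  have lead: "lead_coeff ?A = 1" "lead_coeff ?B = 1"
    by (simp_all add: lead_coeff_prod)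
  have nz: "?A \<noteq> 0" "?B \<noteq> 0" using lead by auto
  have "degree (?A * ?B) = 2 * n - 1"
    using nz deg assms by (subst degree_mult_eq) auto
  then show "degree (binom_prod_poly n) = 2 * n - 1"
    by (simp add: binom_prod_poly_def)
  have "coeff (?A * ?B) (2 * n - 1) = 1"
    using lead_coeff_mult[of ?A ?B] lead \<open>degree (?A * ?B) = 2 * n - 1\<close> by simp
  then show "coeff (binom_prod_poly n) (2 * n - 1) = 1 / (fact n * fact (n - 1))"
    by (simp add: binom_prod_poly_def)
qed

section \<open>Divisibility of the binomial product by \<open>p\<close>\<close>

lemma int_binomial_absorption:
  assumes "k > 0"
  shows "int k * int_binomial z k = z * int_binomial (z - 1) (k - 1)"
proof -
  have "of_int (int_binomial z k) = (of_int z gchoose k :: rat)" for z k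
    by (simp add: of_int_int_binomial gbinomial_prod_rev)
  then have "(of_int (int k * int_binomial z k) :: rat) = of_int (z * int_binomial (z - 1) (k - 1))"
    using gbinomial_absorption[of "k - 1" "of_int z :: rat"] assms by simp
  then show ?thesis by (simp only: of_int_eq_iff)
qed

text \<open>Absorption reads n (z choose n) = z (z - 1 choose n - 1). If n does not divide z, then p
  divides the binomial on the right; if n p divides z, then p divides the one on the left.\<close>

lemma prime_dvd_binom_prod:
  assumes p: "prime p" and n: "n = p ^ e" and "\<not> exact_power p e z"
  shows "int p dvd binom_prod n z"
proof -
  have npos: "n > 0" using p n by (simp add: prime_gt_0_nat)
  have abs: "int n * int_binomial z n = z * int_binomial (z - 1) (n - 1)"
    using int_binomial_absorption[OF npos] .
  have pp: "prime (int p)" using p by simp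
  have "int p dvd int_binomial (z - 1) (n - 1)" if "\<not> int n dvd z"
  proof (rule ccontr)
    assume "\<not> int p dvd int_binomial (z - 1) (n - 1)"
    then have "coprime (int p ^ e) (int_binomial (z - 1) (n - 1))"
      using pp by (simp add: prime_imp_coprime)
    moreover have "int p ^ e dvd z * int_binomial (z - 1) (n - 1)"
      using abs n by (metis dvd_triv_left of_nat_power)
    ultimately show False
      using that n by (simp add: coprime_dvd_mult_left_iff)
  qed
  moreover have "int p dvd int_binomial z n" if "int p ^ Suc e dvd z"
  proof -
    have "int p ^ Suc e dvd int n * int_binomial z n" using abs that by simp
    then show ?thesis using n prime_gt_0_nat[OF p] by simp
  qed
  ultimately show ?thesis
    using assms(3) n unfolding exact_power_def binom_prod_def by auto
qed

text \<open>In Vandermonde's expansion only k = n survives modulo p, contributing 1: p divides (n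
  choose k) for 0 < k < n, and the term k = 0 contains (n - 1 choose n) = 0.\<close>

lemma not_prime_dvd_central:
  assumes p: "prime p" and n: "n = p ^ e"
  shows "\<not> p dvd (2 * n - 1) choose n"
proof -
  have npos: "n > 0" using p n by (simp add: prime_gt_0_nat)
  have small: "p dvd n choose k" if "k > 0" "k < n" for k
  proof (rule ccontr)
    assume "\<not> p dvd n choose k"
    then have "coprime (p ^ e) (n choose k)" using p by (simp add: prime_imp_coprime)
    moreover have "p ^ e dvd k * (n choose k)"
      using n times_binomial_minus1_eq[OF that(1), of n] by simp
    ultimately have "n dvd k" using n by (simp add: coprime_dvd_mult_left_iff)
    then show False using that by (simp add: dvd_imp_le leD)
  qed
  have "(2 * n - 1) choose n = (\<Sum>k\<le>n. (n choose k) * ((n - 1) choose (n - k)))"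
    using npos by (simp add: vandermonde flip: mult_2)
  also have "\<dots> = 1 + (\<Sum>k<n. (n choose k) * ((n - 1) choose (n - k)))"
    using npos by (simp add: lessThan_Suc_atMost[symmetric])
  finally have eq: "(2 * n - 1) choose n = 1 + (\<Sum>k<n. (n choose k) * ((n - 1) choose (n - k)))" .
  have "p dvd (\<Sum>k<n. (n choose k) * ((n - 1) choose (n - k)))"
  proof (rule dvd_sum)
    fix k assume "k \<in> {..<n}"
    then show "p dvd (n choose k) * ((n - 1) choose (n - k))"
      using small npos by (cases "k = 0") (auto simp: binomial_eq_0)
  qed
  then show ?thesis
    using p eq by (metis dvd_add_left_iff not_prime_unit)
qed

lemma central_binomial_fact:
  assumes "n > 0"
  shows "fact (2 * n - 1) / (fact n * fact (n - 1)) = (of_nat ((2 * n - 1) choose n) :: rat)"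
proof -
  have "2 * n - 1 - n = n - 1" using assms by simp
  then show ?thesis
    using assms binomial_fact[of n "2 * n - 1", where 'a = rat] by simp
qed

text \<open>As many differences as the degree leave a constant: (2n - 1)! times the leading
  coefficient times the product of the steps.\<close>

lemma iter_diff_binom_prod_const:
  assumes "n > 0" "length xs = 2 * n - 1"
  shows "iter_diff xs (binom_prod n) y = int ((2 * n - 1) choose n) * prod_list xs"
proof -
  let ?g = "iter_poly_diff (map of_int xs) (binom_prod_poly n)"
  have len: "0 + length (map of_int xs :: rat list) = 2 * n - 1" using assms by simp
  have "degree ?g = 0" and
    c0: "coeff ?g 0 = fact (2 * n - 1) * prod_list (map of_int xs) * (1 / (fact n * fact (n - 1)))"
    using iter_poly_diff_top_coeff[of "binom_prod_poly n" 0 "map of_int xs"]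
      binom_prod_poly_top_coeff[OF assms(1)] unfolding len by auto
  obtain c where c: "?g = [:c:]" using degree_eq_zeroE[OF \<open>degree ?g = 0\<close>] .
  have "prod_list (map of_int xs) = (of_int (prod_list xs) :: rat)"
    by (induction xs) auto
  with c0 have "c = of_nat ((2 * n - 1) choose n) * of_int (prod_list xs)"
    unfolding central_binomial_fact[OF assms(1), symmetric] c by simp
  moreover have "c = of_int (iter_diff xs (binom_prod n) y)"
    using poly_iter_poly_diff[OF poly_binom_prod_poly, of xs n y] unfolding c by simp
  ultimately have "(of_int (iter_diff xs (binom_prod n) y) :: rat)
      = of_int (int ((2 * n - 1) choose n) * prod_list xs)" by simp
  then show ?thesis by (simp only: of_int_eq_iff)
qed

text \<open>The third divided difference at \<open>0, a, b, a + b\<close>, cleared of denominators.\<close>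

lemma cubic_divided_difference:
  fixes g :: "rat poly"
  assumes "degree g \<le> 3"
  shows "(a - b) * poly g (a + b) - (a + b) * poly g a + (a + b) * poly g b - (a - b) * poly g 0
    = coeff g 3 * a * b * (a + b) * (a - b)"
proof -
  have "poly g x = coeff g 0 + coeff g 1 * x + coeff g 2 * x ^ 2 + coeff g 3 * x ^ 3" for x
    using arg_cong[OF poly_as_sum_of_monoms'[OF assms], of "\<lambda>q. poly q x"]
    by (simp add: numeral_eq_Suc atMost_Suc poly_monom algebra_simps)
  then show ?thesis by (simp add: algebra_simps power2_eq_square power3_eq_cube)
qed

text \<open>The factor 6 = 3! clears the denominator left in (2n - 1)!/3!. It stands on the side of
  the values of \<open>G\<close>, so divisibility by \<open>p\<close> passes to the product even for
  p = 2 and p = 3.\<close>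

lemma iter_diff_binom_prod_cubic:
  assumes n: "n \<ge> 2" "length xs = 2 * n - 4"
  defines "G \<equiv> iter_diff xs (binom_prod n)"
  shows "6 * ((a - b) * G (a + b) - (a + b) * G a + (a + b) * G b - (a - b) * G 0)
    = int ((2 * n - 1) choose n) * prod_list xs * a * b * (a + b) * (a - b)"
proof -
  let ?g = "iter_poly_diff (map of_int xs) (binom_prod_poly n)"
  have len: "3 + length (map of_int xs :: rat list) = 2 * n - 1" using assms by simp
  have npos: "n > 0" using n by simp
  have "degree ?g \<le> 3" and
    c3: "coeff ?g 3 = fact (2 * n - 1) / 6 * prod_list (map of_int xs) * (1 / (fact n * fact (n - 1)))"
    using iter_poly_diff_top_coeff[of "binom_prod_poly n" 3 "map of_int xs"]
      binom_prod_poly_top_coeff[OF npos] unfolding len by (auto simp: fact_numeral)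
  note dd = cubic_divided_difference[OF this(1), of "of_int a" "of_int b"]
  have "prod_list (map of_int xs) = (of_int (prod_list xs) :: rat)"
    by (induction xs) auto
  with c3 have c3: "6 * coeff ?g 3 = of_nat ((2 * n - 1) choose n) * of_int (prod_list xs)"
    unfolding central_binomial_fact[OF npos, symmetric] by simp
  have val: "poly ?g (of_int y) = of_int (G y)" for y
    using poly_iter_poly_diff[OF poly_binom_prod_poly, of xs _ y] by (simp add: G_def)
  have "of_int (6 * ((a - b) * G (a + b) - (a + b) * G a + (a + b) * G b - (a - b) * G 0))
      = 6 * coeff ?g 3 * of_int a * of_int b * of_int (a + b) * of_int (a - b)"
    using dd val[of "a + b"] val[of a] val[of b] val[of 0] by simp
  also have "\<dots> = of_int (int ((2 * n - 1) choose n) * prod_list xs * a * b * (a + b) * (a - b))"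
    unfolding c3 by simp
  finally show ?thesis by (simp only: of_int_eq_iff)
qed

subsection \<open>Subsequences with sum of given valuation\<close>

lemma sum_list_take_diff:
  fixes xs :: "int list"
  assumes "i \<le> j"
  shows "sum_list (drop i (take j xs)) = sum_list (take j xs) - sum_list (take i xs)"
proof -
  have "take j xs = take i xs @ drop i (take j xs)"
    using append_take_drop_id[of i "take j xs"] assms by (simp add: min_def)
  then have "sum_list (take j xs) = sum_list (take i xs) + sum_list (drop i (take j xs))"
    by (metis sum_list_append)
  then show ?thesis by simp
qed

text \<open>Pigeonhole: among the n + 1 prefix sums of lengths 0 to n two agree modulo n, and the
  segment between them is the desired subsequence.\<close>

lemma exists_zero_sum_submultiset:
  fixes T :: "int multiset"
  assumes n: "n > 0" and size: "size T \<ge> n"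
  obtains U where "U \<subseteq># T" "U \<noteq> {#}" "size U \<le> n" "int n dvd \<Sum>\<^sub># U"
proof -
  obtain xs where xs: "mset xs = T" using ex_mset by blast
  have len: "length xs \<ge> n" using size xs by (metis size_mset)
  let ?f = "\<lambda>i. sum_list (take i xs) mod int n"
  have "?f ` {0..n} \<subseteq> {0..<int n}" using n by auto
  then have "card (?f ` {0..n}) \<le> card {0..<int n}" by (intro card_mono) auto
  then have "\<not> inj_on ?f {0..n}"
    by (intro pigeonhole) auto
  then obtain i j where ij: "i < j" "j \<le> n" "?f i = ?f j"
    unfolding inj_on_def by (metis atLeastAtMost_iff linorder_neqE_nat)
  define U where "U = mset (drop i (take j xs))"
  have "mset (take i xs) + (U + mset (drop j xs)) = T"
  proof -
    have "take i xs @ drop i (take j xs) @ drop j xs = xs"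
      using ij append_take_drop_id[of i "take j xs"] append_take_drop_id[of j xs]
      by (metis append_assoc min.strict_order_iff take_take)
    then show ?thesis unfolding U_def xs[symmetric] by (metis mset_append)
  qed
  then have "U \<subseteq># T" by (metis mset_subset_eq_add_left mset_subset_eq_add_right subset_mset.order_trans)
  moreover have "size U = j - i" using ij len by (simp add: U_def)
  moreover have "\<Sum>\<^sub># U = sum_list (take j xs) - sum_list (take i xs)"
    using sum_list_take_diff[of i j xs] ij by (simp add: U_def sum_mset_sum_list)
  moreover have "int n dvd sum_list (take j xs) - sum_list (take i xs)"
    using ij(3) by (simp add: mod_eq_dvd_iff dvd_diff_commute)
  ultimately show ?thesis using that[of U] ij by force
qed

text \<open>A longer \<open>T\<close> contains a nonempty zero-sum part modulo \<open>p ^ e\<close>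
  with at most \<open>p ^ e\<close> terms. Either that part already works, or its sum is divisible
  by \<open>p ^ Suc e\<close> and deleting it preserves the valuation.\<close>

lemma exact_power_short:
  assumes p: "p > 0" and T: "exact_power p e (\<Sum>\<^sub># T)"
  shows "\<exists>U. U \<subseteq># T \<and> size U \<le> p ^ e \<and> exact_power p e (\<Sum>\<^sub># U)"
  using T
proof (induction "size T" arbitrary: T rule: less_induct)
  case less
  show ?case
  proof (cases "size T \<le> p ^ e")
    case True
    then show ?thesis using less.prems by auto
  next
    case False
    then obtain U where U: "U \<subseteq># T" "U \<noteq> {#}" "size U \<le> p ^ e" "int (p ^ e) dvd \<Sum>\<^sub># U"
      using exists_zero_sum_submultiset[of "p ^ e" T] p by auto
    obtain V where V: "T = U + V" using U(1) by (auto simp: subset_mset.le_iff_add)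
    show ?thesis
    proof (cases "exact_power p e (\<Sum>\<^sub># U)")
      case True
      then show ?thesis using U by auto
    next
      case no: False
      then have "int p ^ Suc e dvd \<Sum>\<^sub># U" using U(4) by (auto simp: exact_power_def)
      moreover have "int p ^ e dvd \<Sum>\<^sub># U" using U(4) by simp
      ultimately have "exact_power p e (\<Sum>\<^sub># V)"
        using less.prems unfolding V exact_power_def by (simp add: dvd_add_right_iff)
      moreover have "size V < size T" using U(2) V by (simp add: nonempty_has_size)
      ultimately obtain W where "W \<subseteq># V" "size W \<le> p ^ e" "exact_power p e (\<Sum>\<^sub># W)"
        using less.hyps[of V] by auto
      then show ?thesis using V by (metis mset_subset_eq_add_right subset_mset.order_trans)
    qed
  qed
qed

section \<open>Consequences for sequences of units modulo \<open>p\<close>\<close>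

lemma not_prime_dvd_prod_list:
  assumes "prime (p :: int)" "\<And>x. x \<in> set xs \<Longrightarrow> \<not> p dvd x"
  shows "\<not> p dvd prod_list xs"
  using assms by (induction xs) (auto simp: prime_dvd_mult_iff)

lemma obtain_submultiset_size:
  assumes "k \<le> size S"
  obtains U where "U \<subseteq># S" "size U = k"
proof -
  obtain xs where xs: "mset xs = S" using ex_mset by blast
  have "mset (take k xs) \<subseteq># S" unfolding xs[symmetric]
    by (metis append_take_drop_id mset_append mset_subset_eq_add_left)
  moreover have "size (mset (take k xs)) = k" using assms unfolding xs[symmetric] by simp
  ultimately show ?thesis using that by blast
qed

text \<open>Otherwise every value entering the iterated difference is divisible by \<open>p\<close>,
  while the resulting constant is not. The case \<open>e = 0\<close> is included and is needed when
  blocks already have valuation equal to the target.\<close>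

lemma exists_exact_power_submultiset:
  assumes p: "prime p" and size: "size S \<ge> 2 * p ^ e - 1" and units: "\<And>x. x \<in># S \<Longrightarrow> \<not> int p dvd x"
  shows "\<exists>T. T \<subseteq># S \<and> size T \<le> p ^ e \<and> exact_power p e (\<Sum>\<^sub># T)"
proof -
  define n where "n = p ^ e"
  have ppos: "p > 0" using p by (rule prime_gt_0_nat)
  then have npos: "n > 0" by (simp add: n_def)
  have pp: "prime (int p)" using p by simp
  obtain R where R: "R \<subseteq># S" "size R = 2 * n - 1"
    using obtain_submultiset_size[of "2 * n - 1" S] size by (auto simp: n_def)
  obtain xs where xs: "mset xs = R" using ex_mset by blast
  have len: "length xs = 2 * n - 1" using R(2) xs by (metis size_mset)
  have "\<exists>T. T \<subseteq># R \<and> exact_power p e (\<Sum>\<^sub># T)"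
  proof (rule ccontr)
    assume none: "\<not> ?thesis"
    have "int p dvd iter_diff xs (binom_prod n) 0"
      by (rule dvd_iter_diff) (use none xs prime_dvd_binom_prod[OF p n_def] in auto)
    then have "int p dvd int ((2 * n - 1) choose n) \<or> int p dvd prod_list xs"
      unfolding iter_diff_binom_prod_const[OF npos len] using pp by (simp add: prime_dvd_mult_iff)
    moreover have "\<not> int p dvd prod_list xs"
      by (rule not_prime_dvd_prod_list[OF pp]) (use units R xs in \<open>auto dest: mset_subset_eqD\<close>)
    ultimately show False
      using not_prime_dvd_central[OF p n_def] unfolding int_dvd_int_iff by blast
  qed
  then obtain T where T: "T \<subseteq># R" "exact_power p e (\<Sum>\<^sub># T)" by blast
  from exact_power_short[OF ppos T(2)] T(1) R(1) show ?thesis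
    by (meson subset_mset.order_trans)
qed

text \<open>Differencing along the other terms gives a cubic whose values at 0, a, b and a + b are
  divisible by \<open>p\<close>; in the resulting product only a + b and a - b can be.\<close>

lemma pair_congruent_up_to_sign:
  assumes p: "prime p" and e: "e > 0" and size: "size S = 2 * p ^ e - 2"
    and units: "\<And>x. x \<in># S \<Longrightarrow> \<not> int p dvd x"
    and avoid: "\<And>T. T \<subseteq># S \<Longrightarrow> \<not> exact_power p e (\<Sum>\<^sub># T)"
    and pair: "{#a, b#} \<subseteq># S"
  shows "int p dvd a + b \<or> int p dvd a - b"
proof -
  define n where "n = p ^ e"
  have "p ^ 1 \<le> p ^ e" using p e by (intro power_increasing) (auto simp: prime_gt_0_nat Suc_leI)
  then have n2: "n \<ge> 2" using prime_ge_2_nat[OF p] by (simp add: n_def)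
  have pp: "prime (int p)" using p by simp
  obtain R where R: "S = R + {#a, b#}" using pair by (metis subset_mset.diff_add)
  obtain xs where xs: "mset xs = R" using ex_mset by blast
  have "size S = length xs + 2" using R xs by auto
  then have len: "length xs = 2 * n - 4" using size n2 by (simp add: n_def)
  define G where "G = iter_diff xs (binom_prod n)"
  have dvd: "int p dvd G (\<Sum>\<^sub># P)" if "P \<subseteq># {#a, b#}" for P
    unfolding G_def
  proof (rule dvd_iter_diff)
    fix T assume "T \<subseteq># mset xs"
    then have "P + T \<subseteq># S" using that R xs by (metis add.commute subset_mset.add_mono)
    from avoid[OF this] show "int p dvd binom_prod n (\<Sum>\<^sub># P + \<Sum>\<^sub># T)"
      using prime_dvd_binom_prod[OF p n_def] by simp
  qed
  have "int p dvd G (a + b)" "int p dvd G a" "int p dvd G b" "int p dvd G 0"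
    using dvd[of "{#a, b#}"] dvd[of "{#a#}"] dvd[of "{#b#}"] dvd[of "{#}"] by simp_all
  then have "int p dvd 6 * ((a - b) * G (a + b) - (a + b) * G a + (a + b) * G b - (a - b) * G 0)"
    by (intro dvd_mult dvd_add dvd_diff)
  then have "int p dvd int ((2 * n - 1) choose n) * prod_list xs * a * b * (a + b) * (a - b)"
    unfolding G_def iter_diff_binom_prod_cubic[OF n2 len] .
  moreover have "\<not> int p dvd prod_list xs"
    by (rule not_prime_dvd_prod_list[OF pp]) (use units R xs in auto)
  moreover have "\<not> int p dvd int ((2 * n - 1) choose n)"
    using not_prime_dvd_central[OF p n_def] unfolding int_dvd_int_iff .
  moreover have "\<not> int p dvd a" "\<not> int p dvd b" using units R by auto
  ultimately show ?thesis using pp by (simp add: prime_dvd_mult_iff)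
qed

text \<open>Greedy removal: \<open>L\<close> terms guarantee a block, which costs at most
  \<open>q\<close> terms. The last removal needs only \<open>L\<close> terms, so for positive
  \<open>k\<close> the size condition is L + (k - 1) q, written without subtraction.\<close>

lemma extract_blocks:
  fixes S :: "'a multiset"
  assumes block: "\<And>U. U \<subseteq># S \<Longrightarrow> size U \<ge> L \<Longrightarrow> \<exists>B. B \<subseteq># U \<and> size B \<le> q \<and> P B"
    and "size S + q \<ge> L + k * q"
  shows "\<exists>Bs. size Bs = k \<and> \<Sum>\<^sub># Bs \<subseteq># S \<and> (\<forall>B \<in># Bs. P B)"
  using assms
proof (induction k arbitrary: S)
  case 0
  then show ?case by (intro exI[of _ "{#}"]) auto
next
  case (Suc k)
  obtain B where B: "B \<subseteq># S" "size B \<le> q" "P B"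
    using Suc.prems(1)[of S] Suc.prems(2) by auto
  have "size (S - B) = size S - size B" using B(1) by (rule size_Diff_submset)
  then have "size (S - B) + q \<ge> L + k * q"
    using Suc.prems(2) B(2) by simp
  moreover have "\<exists>B. B \<subseteq># U \<and> size B \<le> q \<and> P B" if "U \<subseteq># S - B" "size U \<ge> L" for U
    using Suc.prems(1)[of U] that by (meson diff_subset_eq_self subset_mset.order_trans)
  ultimately obtain Bs where Bs: "size Bs = k" "\<Sum>\<^sub># Bs \<subseteq># S - B" "\<forall>B \<in># Bs. P B"
    using Suc.IH[of "S - B"] by blast
  have "\<Sum>\<^sub># (add_mset B Bs) \<subseteq># S"
    using Bs(2) B(1) by (simp add: subset_eq_diff_conv add.commute subset_mset.le_diff_conv2)
  then show ?case using Bs B(3) by (intro exI[of _ "add_mset B Bs"]) auto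
qed

text \<open>Block sums divided by \<open>p ^ k\<close> are units, so the result for units with
  exponent \<open>e - k\<close> selects some of them; the union of the selected blocks has valuation
  \<open>e\<close>.\<close>

lemma exact_power_of_blocks:
  assumes p: "prime p" and ke: "k \<le> e" and size: "size Bs \<ge> 2 * p ^ (e - k) - 1"
    and blocks: "\<And>B. B \<in># Bs \<Longrightarrow> exact_power p k (\<Sum>\<^sub># B)"
  shows "\<exists>T. T \<subseteq># \<Sum>\<^sub># Bs \<and> exact_power p e (\<Sum>\<^sub># T)"
proof -
  have ppos: "int p > 0" using prime_gt_0_nat[OF p] by simp
  define h where "h B = \<Sum>\<^sub># B div int p ^ k" for B
  have h: "\<Sum>\<^sub># B = int p ^ k * h B" "\<not> int p dvd h B" if B: "B \<in># Bs" for B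
  proof -
    show eq: "\<Sum>\<^sub># B = int p ^ k * h B"
      using blocks[OF B] by (simp add: h_def exact_power_def)
    show "\<not> int p dvd h B"
      using blocks[OF B] ppos unfolding exact_power_def eq by (simp add: mult.commute)
  qed
  obtain V where V: "V \<subseteq># image_mset h Bs" "exact_power p (e - k) (\<Sum>\<^sub># V)"
    using exists_exact_power_submultiset[OF p, of "e - k" "image_mset h Bs"] size h(2) by auto
  \<comment> \<open>Lifts the selected quotients back to the blocks they come from, with
    multiplicity.\<close>
  obtain Bs' where Bs': "Bs' \<subseteq># Bs" "V = image_mset h Bs'"
    using V(1) by (metis image_mset_eq_plusD mset_subset_eq_add_left subset_mset.diff_add add.commute)
  have "\<Sum>\<^sub># (\<Sum>\<^sub># Bs') = int p ^ k * \<Sum>\<^sub># (image_mset h Bs')"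
    using Bs'(1)
  proof (induction Bs')
    case (add B Bs')
    then have "B \<in># Bs" "Bs' \<subseteq># Bs" by (auto dest: mset_subset_eq_insertD)
    then show ?case using add.IH h(1)[of B] by (simp add: distrib_left)
  qed simp
  then have "exact_power p e (\<Sum>\<^sub># (\<Sum>\<^sub># Bs'))"
    using V(2) ke ppos unfolding Bs'(2) exact_power_def
    by (metis Suc_diff_le dvd_mult_cancel_left le_SucI le_add_diff_inverse power_add power_not_zero less_irrefl)
  moreover have "\<Sum>\<^sub># Bs' \<subseteq># \<Sum>\<^sub># Bs"
    using Bs'(1) by (metis subset_mset.le_iff_add sum_mset.union)
  ultimately show ?thesis by blast
qed

section \<open>The gcd condition as a p-adic valuation\<close>

lemma gcd_square_eq_iff_exact_power:
  assumes p: "prime p" and e: "e > 0" and n: "n = p ^ e"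
  shows "gcd z ((int n)\<^sup>2) = int n \<longleftrightarrow> exact_power p e z"
proof
  assume g: "gcd z ((int n)\<^sup>2) = int n"
  have "int n dvd z" using g by (metis gcd_dvd1)
  moreover have "\<not> int p ^ Suc e dvd z"
  proof
    assume "int p ^ Suc e dvd z"
    \<comment> \<open>Here \<open>e > 0\<close> enters, as e + 1 <= 2e.\<close>
    moreover have "int p ^ Suc e dvd (int n)\<^sup>2"
      unfolding n of_nat_power power_mult[symmetric] by (rule le_imp_power_dvd) (use e in simp)
    ultimately have "int p ^ Suc e dvd int p ^ e"
      using g n by (metis gcd_greatest of_nat_power)
    then have "p ^ Suc e dvd p ^ e" unfolding of_nat_power[symmetric] int_dvd_int_iff .
    then show False using power_dvd_imp_le[OF _ prime_gt_1_nat[OF p]] by fastforce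
  qed
  ultimately show "exact_power p e z" using n by (simp add: exact_power_def)
next
  assume ex: "exact_power p e z"
  have "prime (int p)" using p by simp
  \<comment> \<open>The gcd is thus a power of \<open>p\<close>, and its exponent is pinned to
    \<open>e\<close> from both sides.\<close>
  moreover have "gcd z ((int n)\<^sup>2) dvd int p ^ (e * 2)" using n by (simp add: power_mult)
  ultimately obtain i where i: "gcd z ((int n)\<^sup>2) = int p ^ i"
    using divides_primepow[of "int p" "gcd z ((int n)\<^sup>2)" "e * 2"] by auto
  have "int p ^ e dvd gcd z ((int n)\<^sup>2)"
    using ex n by (simp add: exact_power_def power2_eq_square)
  then have "int (p ^ e) dvd int (p ^ i)" using i by simp
  then have "p ^ e dvd p ^ i" unfolding int_dvd_int_iff .
  then have "e \<le> i" using power_dvd_imp_le[OF _ prime_gt_1_nat[OF p]] by blast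
  moreover have "\<not> Suc e \<le> i"
  proof
    assume "Suc e \<le> i"
    then have "int p ^ Suc e dvd z" using i by (metis gcd_dvd1 le_imp_power_dvd dvd_trans)
    then show False using ex by (simp add: exact_power_def)
  qed
  ultimately show "gcd z ((int n)\<^sup>2) = int n" using i n by (simp add: le_antisym not_less_eq_eq)
qed

lemma cong_sum_mset_const:
  assumes "\<And>x. x \<in># T \<Longrightarrow> [x = c] (mod (m :: int))"
  shows "[\<Sum>\<^sub># T = int (size T) * c] (mod m)"
  using assms
proof (induction T)
  case (add x T)
  then have "[x + \<Sum>\<^sub># T = c + int (size T) * c] (mod m)" by (intro cong_add) auto
  then show ?case by (simp add: algebra_simps)
qed simp

subsection \<open>Extremal sequences\<close>

text \<open>Modulo 2 a unit and its negative coincide; for \<open>p = 2\<close> the two classes \<open>c\<close> and \<open>- c\<close>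
  only separate modulo 4.\<close>

definition sign_modulus :: "nat \<Rightarrow> nat"
  where "sign_modulus p = (if p = 2 then 4 else p)"

text \<open>\<open>avoid\<close> has no length bound; by \<open>exact_power_short\<close> this is
  equivalent to the bounded form, and unions of blocks may then be used whatever their
  length.\<close>

locale avoiding_multiset =
  fixes p e :: nat and S :: "int multiset"
  assumes p: "prime p" and e: "e > 0"
    and size_S: "size S = 2 * p ^ e - 2"
    and units: "\<And>x. x \<in># S \<Longrightarrow> \<not> int p dvd x"
    and avoid: "\<And>T. T \<subseteq># S \<Longrightarrow> \<not> exact_power p e (\<Sum>\<^sub># T)"
begin

lemma ppos: "p > 0" and p2: "p \<ge> 2" and pp: "prime (int p)"
  using p by (auto simp: prime_gt_0_nat prime_ge_2_nat)

text \<open>Source of the contradictions below: disjoint blocks of valuation \<open>k\<close> cannot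
  be too numerous.\<close>

lemma block_bound:
  assumes "k \<le> e" "\<Sum>\<^sub># Bs \<subseteq># S" "\<And>B. B \<in># Bs \<Longrightarrow> exact_power p k (\<Sum>\<^sub># B)"
  shows "size Bs < 2 * p ^ (e - k) - 1"
  using exact_power_of_blocks[OF p assms(1) _ assms(3), of Bs] avoid assms(2)
  by (meson not_le subset_mset.order_trans)

lemma pair_not_exact_power:
  assumes pair: "{#x, y#} \<subseteq># S" and k: "k \<le> e" "p ^ k > 2"
  shows "\<not> exact_power p k (x + y)"
proof
  assume ex: "exact_power p k (x + y)"
  define q where "q = p ^ k"
  define m where "m = p ^ (e - k)"
  have "p ^ e = m * q" using k(1) by (simp add: m_def q_def flip: power_add)
  have mpos: "m > 0" using ppos by (simp add: m_def)
  obtain R where R: "S = R + {#x, y#}" using pair by (metis subset_mset.diff_add)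
  \<comment> \<open>Since \<open>R\<close> has 2mq - 4 terms, the inequality amounts to q >= 3,
    which is the hypothesis on \<open>p ^ k\<close>.\<close>
  have size: "size R + q \<ge> (2 * q - 1) + (2 * m - 2) * q"
  proof -
    have "(2 * m - 2) * q + 2 * q = 2 * (m * q)" using mpos by (cases m) (auto simp: algebra_simps)
    moreover have "size R + 4 = 2 * (m * q)"
      using size_S R \<open>p ^ e = m * q\<close> k(2) mpos by (cases m) (auto simp: q_def)
    ultimately show ?thesis using k(2) q_def by linarith
  qed
  have block: "\<exists>B. B \<subseteq># U \<and> size B \<le> q \<and> exact_power p k (\<Sum>\<^sub># B)"
    if "U \<subseteq># R" "2 * q - 1 \<le> size U" for U
    unfolding q_def
    by (rule exists_exact_power_submultiset[OF p])
      (use that R units in \<open>auto simp: q_def dest: mset_subset_eqD\<close>)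
  obtain Bs where Bs: "size Bs = 2 * m - 2" "\<Sum>\<^sub># Bs \<subseteq># R" "\<forall>B \<in># Bs. exact_power p k (\<Sum>\<^sub># B)"
    using extract_blocks[of R, OF block size] by blast
  have "\<Sum>\<^sub># (add_mset {#x, y#} Bs) \<subseteq># S"
    using Bs(2) R by (metis add.commute subset_mset.add_right_mono sum_mset.add_mset)
  then have "size (add_mset {#x, y#} Bs) < 2 * m - 1"
    unfolding m_def by (intro block_bound[OF k(1)]) (use Bs ex in auto)
  then show False using Bs(1) mpos by simp
qed

lemma exact_power_one_const:
  assumes "x \<in># S" "size B = p" "\<And>z. z \<in># B \<Longrightarrow> [z = x] (mod (int p)\<^sup>2)"
  shows "exact_power p 1 (\<Sum>\<^sub># B)"
proof -
  have cong: "[\<Sum>\<^sub># B = int p * x] (mod (int p)\<^sup>2)"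
    using cong_sum_mset_const[of B x "(int p)\<^sup>2"] assms(2,3) by simp
  have "\<not> (int p)\<^sup>2 dvd int p * x"
    using units[OF assms(1)] ppos by (simp add: power2_eq_square)
  then have "\<not> (int p)\<^sup>2 dvd \<Sum>\<^sub># B" using cong cong_dvd_iff by blast
  moreover have "int p dvd \<Sum>\<^sub># B"
    using cong_dvd_iff[OF cong_modulus_mult[OF cong[unfolded power2_eq_square]]] by simp
  ultimately show ?thesis by (simp add: exact_power_def power2_eq_square)
qed

text \<open>When all terms agree modulo \<open>p\<close>, every sum of \<open>p\<close> terms is
  divisible by \<open>p\<close>. If two terms differ modulo p^2, exchanging one for the other
  changes such a sum modulo p^2, so one of the two sums has valuation 1. Hence p + 1 terms suffice
  instead of 2p - 1.\<close>

lemma exact_power_one_block: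
  assumes U: "U \<subseteq># S" "size U \<ge> p + 1" and const: "\<And>x y. x \<in># U \<Longrightarrow> y \<in># U \<Longrightarrow> [x = y] (mod int p)"
  shows "\<exists>B. B \<subseteq># U \<and> size B \<le> p \<and> exact_power p 1 (\<Sum>\<^sub># B)"
proof (cases "\<forall>x \<in># U. \<forall>y \<in># U. [x = y] (mod (int p)\<^sup>2)")
  case True
  obtain B where B: "B \<subseteq># U" "size B = p" using obtain_submultiset_size[of p U] U(2) by auto
  obtain x where "x \<in># U" using U(2) by fastforce
  then have "exact_power p 1 (\<Sum>\<^sub># B)"
    by (intro exact_power_one_const[of x]) (use True B U in \<open>auto dest: mset_subset_eqD\<close>)
  then show ?thesis using B by auto
next
  case False
  then obtain x y where xy: "x \<in># U" "y \<in># U" "\<not> [x = y] (mod (int p)\<^sup>2)" by blast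
  then have "x \<noteq> y" by auto
  then obtain V where V: "U = {#x, y#} + V"
    using xy by (metis insert_noteq_member mset_add add_mset_add_single union_mset_add_mset_left add_mset_commute add.commute)
  have "p - 1 \<le> size V" using U(2) V by simp
  then obtain Q where Q: "Q \<subseteq># V" "size Q = p - 1" by (rule obtain_submultiset_size)
  have sub: "add_mset x Q \<subseteq># U" "add_mset y Q \<subseteq># U"
  proof -
    obtain W where "V = Q + W" using Q(1) by (auto simp: subset_mset.le_iff_add)
    then have "U = add_mset x Q + add_mset y W" "U = add_mset y Q + add_mset x W"
      using V by simp_all
    then show "add_mset x Q \<subseteq># U" "add_mset y Q \<subseteq># U"
      by (metis mset_subset_eq_add_left)+
  qed
  have dvd: "int p dvd \<Sum>\<^sub># B" if B: "B \<subseteq># U" "size B = p" for B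
  proof -
    have "[\<Sum>\<^sub># B = int (size B) * x] (mod int p)"
      by (rule cong_sum_mset_const) (use B xy const in \<open>auto dest: mset_subset_eqD\<close>)
    then show ?thesis using B(2) cong_dvd_iff[of _ _ "int p"] by fastforce
  qed
  have size: "size (add_mset x Q) = p" "size (add_mset y Q) = p" using Q(2) ppos by auto
  have "\<not> ((int p)\<^sup>2 dvd \<Sum>\<^sub># (add_mset x Q) \<and> (int p)\<^sup>2 dvd \<Sum>\<^sub># (add_mset y Q))"
    using xy(3) dvd_diff[of "(int p)\<^sup>2" "\<Sum>\<^sub># (add_mset x Q)" "\<Sum>\<^sub># (add_mset y Q)"]
    by (auto simp: cong_iff_dvd_diff)
  then have "exact_power p 1 (\<Sum>\<^sub># (add_mset x Q)) \<or> exact_power p 1 (\<Sum>\<^sub># (add_mset y Q))"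
    using dvd[OF sub(1) size(1)] dvd[OF sub(2) size(2)]
    by (auto simp: exact_power_def power2_eq_square)
  then show ?thesis using sub size by (metis order_refl)
qed

text \<open>Congruent terms yield blocks so cheaply that 2m - 1 disjoint ones of valuation 1 fit
  into \<open>S\<close>, one more than \<open>block_bound\<close> allows.\<close>

lemma not_all_congruent: "\<exists>x \<in># S. \<exists>y \<in># S. \<not> [x = y] (mod int (sign_modulus p))"
proof (rule ccontr)
  assume "\<not> ?thesis"
  then have const: "[x = y] (mod int (sign_modulus p))" if "x \<in># S" "y \<in># S" for x y using that by blast
  define m where "m = p ^ (e - 1)"
  have pe: "p ^ e = m * p" using e by (simp add: m_def power_eq_if)
  have mpos: "m > 0" using ppos by (simp add: m_def)
  \<comment> \<open>The count below requires L <= 2p - 2, so the general threshold 2p - 1 just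
    fails. For odd \<open>p\<close>, p + 1 is small enough; for p = 2, any two odd numbers congruent
    modulo 4 have sum 2 modulo 4.\<close>
  define L where "L = (if p = 2 then 2 else p + 1)"
  have size: "size S + p \<ge> L + (2 * m - 1) * p"
  proof -
    have "(2 * m - 1) * p + p = 2 * (m * p)" using mpos by (cases m) (auto simp: algebra_simps)
    moreover have "m * p \<ge> 2" using mpos p2 by (metis One_nat_def Suc_leI mult_le_mono nat_mult_1)
    moreover have "p \<noteq> 2 \<Longrightarrow> p \<ge> 3" using p2 by linarith
    ultimately show ?thesis using size_S pe p2 by (auto simp: L_def)
  qed
  have block: "\<exists>B. B \<subseteq># U \<and> size B \<le> p \<and> exact_power p 1 (\<Sum>\<^sub># B)"
    if U: "U \<subseteq># S" "L \<le> size U" for U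
  proof (cases "p = 2")
    case True
    obtain B where B: "B \<subseteq># U" "size B = p"
      using obtain_submultiset_size[of p U] U(2) True by (auto simp: L_def)
    obtain x where "x \<in># B" using B(2) ppos by fastforce
    then have "x \<in># S" using B U by (meson mset_subset_eqD)
    then have "exact_power p 1 (\<Sum>\<^sub># B)"
      by (rule exact_power_one_const[OF _ B(2)])
        (use True B U const \<open>x \<in># S\<close> in \<open>auto simp: sign_modulus_def dest!: mset_subset_eqD\<close>)
    then show ?thesis using B by auto
  next
    case False
    then show ?thesis
      by (intro exact_power_one_block) (use U const in \<open>auto simp: sign_modulus_def L_def dest: mset_subset_eqD\<close>)
  qed
  obtain Bs where Bs: "size Bs = 2 * m - 1" "\<Sum>\<^sub># Bs \<subseteq># S" "\<forall>B \<in># Bs. exact_power p 1 (\<Sum>\<^sub># B)"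
    using extract_blocks[of S, OF block size] by blast
  have "size Bs < 2 * m - 1"
    unfolding m_def by (rule block_bound) (use Bs e in auto)
  then show False using Bs(1) by simp
qed

text \<open>The power of \<open>p\<close> dividing x + y climbs one exponent at a time, because
  \<open>pair_not_exact_power\<close> forbids it to stop at any \<open>k\<close> up to
  \<open>e\<close>.\<close>

lemma opposite_of_not_congruent:
  assumes xy: "x \<in># S" "y \<in># S" "\<not> [x = y] (mod int (sign_modulus p))"
  shows "[x = - y] (mod int p ^ Suc e)"
proof -
  have "x \<noteq> y" using xy by auto
  then have pair: "{#x, y#} \<subseteq># S"
    using xy by (metis insert_noteq_member insert_subset_eq_iff mset_add single_subset_iff add_mset_remove_trivial)
  \<comment> \<open>For p = 2 the climb starts at 2, as \<open>p ^ k > 2\<close> fails at k = 1; two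
    odd numbers not congruent modulo 4 have sum divisible by 4.\<close>
  define j where "j = (if p = 2 then 2 else 1 :: nat)"
  have base: "int p ^ j dvd x + y"
  proof (cases "p = 2")
    case True
    have "odd x" "odd y" using units[OF xy(1)] units[OF xy(2)] True by auto
    moreover have "\<not> 4 dvd x - y" using xy(3) True by (simp add: sign_modulus_def cong_iff_dvd_diff)
    ultimately show ?thesis using True unfolding j_def by simp presburger
  next
    case False
    then show ?thesis
      using pair_congruent_up_to_sign[OF p e size_S units avoid pair] xy(3)
      by (auto simp: j_def sign_modulus_def cong_iff_dvd_diff)
  qed
  have "int p ^ k dvd x + y" if "j \<le> k" "k \<le> Suc e" for k
    using that
  proof (induction k rule: dec_induct)
    case (step k)
    have "p ^ k > 2"
    proof (cases "p = 2")
      case True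
      then have "(2::nat) ^ 2 \<le> 2 ^ k" using step(1) by (intro power_increasing) (auto simp: j_def)
      then show ?thesis using True by simp
    next
      case False
      then have "p ^ 1 \<le> p ^ k" using step(1) ppos by (intro power_increasing) (auto simp: j_def)
      then show ?thesis using False p2 by simp
    qed
    then have "\<not> exact_power p k (x + y)" using pair_not_exact_power[OF pair] step by simp
    then show ?case using step by (simp add: exact_power_def)
  qed (rule base)
  from this[of "Suc e"] have "int p ^ Suc e dvd x + y" using e by (simp add: j_def split: if_splits)
  then show ?thesis by (simp add: cong_iff_dvd_diff)
qed

text \<open>The sum of \<open>p ^ e\<close> terms congruent to the unit \<open>c\<close> is
  \<open>p ^ e * c\<close> modulo \<open>p ^ Suc e\<close>, hence of valuation exactly
  \<open>e\<close>.\<close>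

lemma size_congruent_class:
  assumes A: "A \<subseteq># S" and cong: "\<And>x. x \<in># A \<Longrightarrow> [x = c] (mod int p ^ Suc e)" and c: "\<not> int p dvd c"
  shows "size A \<le> p ^ e - 1"
proof (rule ccontr)
  assume "\<not> ?thesis"
  then have "p ^ e \<le> size A" by simp
  then obtain B where B: "B \<subseteq># A" "size B = p ^ e" by (rule obtain_submultiset_size)
  have sum: "[\<Sum>\<^sub># B = int p ^ e * c] (mod int p ^ Suc e)"
    using cong_sum_mset_const[of B c "int p ^ Suc e"] cong B by (auto dest: mset_subset_eqD)
  have "\<not> int p ^ Suc e dvd \<Sum>\<^sub># B"
    unfolding cong_dvd_iff[OF sum] using c ppos by (simp add: mult.commute)
  moreover have "[\<Sum>\<^sub># B = int p ^ e * c] (mod int p ^ e)"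
    using sum by (rule cong_dvd_modulus) simp
  then have "int p ^ e dvd \<Sum>\<^sub># B" by (simp add: cong_dvd_iff)
  ultimately show False
    using avoid[of B] A B(1) by (auto simp: exact_power_def intro: subset_mset.order_trans)
qed

text \<open>Fix c and y incongruent modulo \<open>sign_modulus p\<close>, so c = -y modulo
  \<open>p ^ Suc e\<close>. Every term is incongruent to c or to y, hence opposite to one of them.
  Each class has at most n - 1 terms, and the total 2n - 2 forces equality.\<close>

lemma two_classes:
  "\<exists>c A B. \<not> int p dvd c \<and> S = A + B \<and> size A = p ^ e - 1 \<and> size B = p ^ e - 1 \<and>
    (\<forall>x \<in># A. [x = c] (mod int p ^ Suc e)) \<and> (\<forall>x \<in># B. [x = - c] (mod int p ^ Suc e))"
proof -
  obtain c y where cy: "c \<in># S" "y \<in># S" "\<not> [c = y] (mod int (sign_modulus p))" using not_all_congruent by blast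
  have cy': "[c = - y] (mod int p ^ Suc e)" using opposite_of_not_congruent[OF cy] .
  have dich: "[z = c] (mod int p ^ Suc e) \<or> [z = - c] (mod int p ^ Suc e)" if z: "z \<in># S" for z
  proof (cases "[z = c] (mod int (sign_modulus p))")
    case True
    then have "\<not> [z = y] (mod int (sign_modulus p))" using cy(3) by (metis cong_sym cong_trans)
    then have "[z = - y] (mod int p ^ Suc e)" using opposite_of_not_congruent z cy by blast
    then show ?thesis using cy' by (metis cong_sym cong_trans)
  next
    case False
    then show ?thesis using opposite_of_not_congruent z cy by blast
  qed
  define A where "A = {#z \<in># S. [z = c] (mod int p ^ Suc e)#}"
  define B where "B = {#z \<in># S. \<not> [z = c] (mod int p ^ Suc e)#}"
  have S: "S = A + B" unfolding A_def B_def by (rule multiset_partition)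
  have A: "\<forall>x \<in># A. [x = c] (mod int p ^ Suc e)" by (simp add: A_def)
  have B: "\<forall>x \<in># B. [x = - c] (mod int p ^ Suc e)" using dich by (auto simp: B_def)
  have c: "\<not> int p dvd c" using units cy by blast
  have "size A \<le> p ^ e - 1" by (rule size_congruent_class) (use S A c in auto)
  moreover have "size B \<le> p ^ e - 1"
    by (rule size_congruent_class[of _ "- c"]) (use S B c in auto)
  moreover have "size A + size B = 2 * p ^ e - 2" using S size_S by simp
  ultimately have "size A = p ^ e - 1" "size B = p ^ e - 1" by linarith+
  then show ?thesis using S A B c by blast
qed

end

text \<open>With u terms from \<open>A\<close> and v from \<open>B\<close> the sum is (u - v) c
  modulo \<open>p ^ Suc e\<close>, where u - v is less than \<open>p ^ e\<close> in absolute value.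
  Divisibility by \<open>p ^ e\<close> forces u = v, and then \<open>p ^ Suc e\<close> divides the
  sum.\<close>

lemma two_classes_avoid:
  assumes p: "prime p" and A: "size A < p ^ e" "\<And>x. x \<in># A \<Longrightarrow> [x = c] (mod int p ^ Suc e)"
    and B: "size B < p ^ e" "\<And>x. x \<in># B \<Longrightarrow> [x = - c] (mod int p ^ Suc e)"
    and c: "\<not> int p dvd c" and T: "T \<subseteq># A + B"
  shows "\<not> exact_power p e (\<Sum>\<^sub># T)"
proof
  assume ex: "exact_power p e (\<Sum>\<^sub># T)"
  define U where "U = T \<inter># A"
  define V where "V = T - A"
  have "T = U + V" by (rule multiset_eqI) (simp add: U_def V_def min_def)
  moreover have "V \<subseteq># B" using T unfolding V_def subset_eq_diff_conv by (metis add.commute)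
  ultimately have UV: "T = U + V" "U \<subseteq># A" "V \<subseteq># B" by (simp_all add: U_def)
  have "[\<Sum>\<^sub># U + \<Sum>\<^sub># V = int (size U) * c + int (size V) * (- c)] (mod int p ^ Suc e)"
    by (intro cong_add cong_sum_mset_const) (use A B UV in \<open>auto dest: mset_subset_eqD\<close>)
  then have sum: "[\<Sum>\<^sub># T = (int (size U) - int (size V)) * c] (mod int p ^ Suc e)"
    by (simp add: UV algebra_simps)
  have "[\<Sum>\<^sub># T = (int (size U) - int (size V)) * c] (mod int p ^ e)"
    using sum by (rule cong_dvd_modulus) simp
  then have "int p ^ e dvd (int (size U) - int (size V)) * c"
    using ex by (simp add: exact_power_def cong_dvd_iff)
  moreover have "coprime (int p ^ e) c" using p c by (simp add: prime_imp_coprime)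
  ultimately have dvd: "int p ^ e dvd int (size U) - int (size V)"
    by (simp add: coprime_dvd_mult_left_iff)
  have "size U < p ^ e" "size V < p ^ e"
    using UV A(1) B(1) size_mset_mono[of U A] size_mset_mono[of V B] by simp_all
  then have "int (size U) < int (p ^ e)" "int (size V) < int (p ^ e)" by (simp_all only: of_nat_less_iff)
  then have "\<bar>int (size U) - int (size V)\<bar> < \<bar>int p ^ e\<bar>" unfolding of_nat_power by linarith
  then have "int (size U) - int (size V) = 0"
    using dvd_imp_le_int[OF _ dvd] by (meson not_le)
  then show False using sum ex by (simp add: exact_power_def cong_dvd_iff)
qed

theorem theorem1p5:
  fixes p e n :: nat and S :: "int multiset"
  assumes "prime p" and "e \<ge> 1" and "n = p ^ e"
    and "size S = 2 * n - 2"
    and "\<forall>x \<in># S. coprime x (int n)"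
  shows "((\<not> (\<exists>T. T \<subseteq># S \<and> size T \<le> n \<and> gcd (\<Sum>\<^sub># T) ((int n)\<^sup>2) = int n)) \<longleftrightarrow>
          (\<exists>c::int. coprime c (int n) \<and>
            (\<exists>A B. S = A + B \<and> size A = n - 1 \<and> size B = n - 1 \<and>
               (\<forall>x \<in># A. [x = c] (mod (int n * int p))) \<and>
               (\<forall>x \<in># B. [x = - c] (mod (int n * int p)))))) \<and>
         ((\<not> (\<exists>T. T \<subseteq># S \<and> size T \<le> n \<and> gcd (\<Sum>\<^sub># T) ((int n)\<^sup>2) = int n)) \<longrightarrow>
          (\<not> (\<exists>T. T \<subseteq># S \<and> gcd (\<Sum>\<^sub># T) ((int n)\<^sup>2) = int n)))"
proof -
  have e: "e > 0" using assms(2) by simp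
  have ppos: "p > 0" using assms(1) by (rule prime_gt_0_nat)
  have gcd: "gcd z ((int n)\<^sup>2) = int n \<longleftrightarrow> exact_power p e z" for z
    by (rule gcd_square_eq_iff_exact_power[OF assms(1) e assms(3)])
  have cop: "coprime x (int n) \<longleftrightarrow> \<not> int p dvd x" for x
    using assms(1,3) e by (simp add: coprime_commute[of x] prime_int_nat_transfer)
      (metis coprime_absorb_left not_prime_unit of_nat_dvd_iff prime_imp_coprime prime_nat_int_transfer)
  have np: "int n * int p = int p ^ Suc e" using assms(3) by simp
  \<comment> \<open>This gives the final assertion at once and lets both directions of the
    equivalence be proved without the length bound.\<close>
  have short: "(\<exists>T. T \<subseteq># S \<and> size T \<le> n \<and> exact_power p e (\<Sum>\<^sub># T)) \<longleftrightarrow>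
      (\<exists>T. T \<subseteq># S \<and> exact_power p e (\<Sum>\<^sub># T))"
    using exact_power_short[OF ppos] assms(3) by (meson subset_mset.order_trans)
  have "\<exists>c. coprime c (int n) \<and>
      (\<exists>A B. S = A + B \<and> size A = n - 1 \<and> size B = n - 1 \<and>
        (\<forall>x \<in># A. [x = c] (mod int p ^ Suc e)) \<and> (\<forall>x \<in># B. [x = - c] (mod int p ^ Suc e)))"
    if "\<not> (\<exists>T. T \<subseteq># S \<and> exact_power p e (\<Sum>\<^sub># T))"
  proof -
    interpret avoiding_multiset p e S
      by unfold_locales (use that assms e cop in auto)
    show ?thesis using two_classes unfolding cop unfolding assms(3) by blast
  qed
  moreover have "\<not> (\<exists>T. T \<subseteq># S \<and> exact_power p e (\<Sum>\<^sub># T))"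
    if "coprime c (int n)" "S = A + B" "size A = n - 1" "size B = n - 1"
      "\<forall>x \<in># A. [x = c] (mod int p ^ Suc e)" "\<forall>x \<in># B. [x = - c] (mod int p ^ Suc e)" for c A B
    using two_classes_avoid[OF assms(1), of A e c B] that ppos assms(3) unfolding cop by auto
  ultimately show ?thesis unfolding gcd short np by blast
qed

end
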